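(* Let $d\ge 1$ and $\mathcal X_\bullet=\mathcal Y_\bullet=\{x\in\mathbb R^d:\|x\|_2\le 1\}$. For $x\in\mathcal X_\bullet$ define in $\mathbb R^{d+2}$ $$P(x)=\big[x;\sqrt{1-\|x\|_2^2};0\big],\qquad Q(x)=\big[x;0;\sqrt{1-\|x\|_2^2}\big],$$ and let SIMPLE-ALSH be the asymmetric hash $(f,g)$ given by $f(x)=\mathrm{sign}(a^\top P(x))$ and $g(y)=\mathrm{sign}(a^\top Q(y))$, where $a\sim\mathcal N(0,I_{d+2})$ is the same random vector for both. Then SIMPLE-ALSH is a universal ALSH for the inner product similarity $\mathrm{sim}(x,y)=x^\top y$ over $\mathcal X_\bullet,\mathcal Y_\bullet$; that is, for every $0<S<1$ and $0<c<1$ it is an $(S,cS)$-ALSH over $\mathcal X_\bullet,\mathcal Y_\bullet$.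
   Context: An asymmetric hash for a pair of sets $\mathcal X,\mathcal Y$ is a joint probability distribution over pairs of mappings $(f,g)$ with $f:\mathcal X\to\Gamma$ and $g:\mathcal Y\to\Gamma$, where $\Gamma$ is some set (the alphabet; here $\{\pm1\}$). Given $\mathrm{sim}:\mathcal X\times\mathcal Y\to\mathbb R$, an asymmetric hash is an $(S,cS,p_1,p_2)$-ALSH for $\mathrm{sim}$ over $\mathcal X,\mathcal Y$ if for all $x\in\mathcal X$, $y\in\mathcal Y$: (i) if $\mathrm{sim}(x,y)\ge S$ then $\mathbb P_{(f,g)}[f(x)=g(y)]\ge p_1$; (ii) if $\mathrm{sim}(x,y)\le cS$ then $\mathbb P_{(f,g)}[f(x)=g(y)]\le p_2$. It is an $(S,cS)$-ALSH if there exist $p_1,p_2\in[0,1]$ with $p_1>p_2$ such that it is an $(S,cS,p_1,p_2)$-ALSH. The notation $[u;v;w]$ denotes concatenation of vectors; $\mathrm{sign}(t)=1$ for $t\geq 0$ and $-1$ for $t<0$ (the value at $0$ is immaterial). *)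

theory Defs
  imports "HOL-Probability.Probability"
begin

text \<open>
  An asymmetric hash is a probability measure \<open>H\<close> on pairs of mappings
  \<open>f : X \<rightarrow> \<Gamma>\<close>, \<open>g : Y \<rightarrow> \<Gamma>\<close>; mappings with a given domain are
  represented by extensional functions. The collision events have to be measurable for their
  probabilities to make sense (\<^const>\<open>measure\<close> is 0 on non-measurable sets).
\<close>

definition collision ::
  "(('x \<Rightarrow> 'c) \<times> ('y \<Rightarrow> 'c)) measure \<Rightarrow> 'x \<Rightarrow> 'y \<Rightarrow> (('x \<Rightarrow> 'c) \<times> ('y \<Rightarrow> 'c)) set" where
  "collision H x y = {(f, g) \<in> space H. f x = g y}"

definition asymmetric_hash ::
  "'x set \<Rightarrow> 'y set \<Rightarrow> 'c set \<Rightarrow> (('x \<Rightarrow> 'c) \<times> ('y \<Rightarrow> 'c)) measure \<Rightarrow> bool" where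
  "asymmetric_hash X Y \<Gamma> H \<longleftrightarrow>
     prob_space H \<and> space H = (X \<rightarrow>\<^sub>E \<Gamma>) \<times> (Y \<rightarrow>\<^sub>E \<Gamma>) \<and>
     (\<forall>x\<in>X. \<forall>y\<in>Y. collision H x y \<in> sets H)"

text \<open>
  \<open>ALSH_with sim X Y \<Gamma> S c p1 p2 H\<close>: the hash \<open>H\<close> is an \<open>(S, cS, p1, p2)\<close>-ALSH for \<open>sim\<close>;
  \<open>ALSH sim X Y \<Gamma> S c H\<close>: it is an \<open>(S, cS)\<close>-ALSH.
\<close>

definition ALSH_with ::
  "('x \<Rightarrow> 'y \<Rightarrow> real) \<Rightarrow> 'x set \<Rightarrow> 'y set \<Rightarrow> 'c set \<Rightarrow> real \<Rightarrow> real \<Rightarrow> real \<Rightarrow> real \<Rightarrow>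
   (('x \<Rightarrow> 'c) \<times> ('y \<Rightarrow> 'c)) measure \<Rightarrow> bool" where
  "ALSH_with sim X Y \<Gamma> S c p1 p2 H \<longleftrightarrow>
     asymmetric_hash X Y \<Gamma> H \<and>
     (\<forall>x\<in>X. \<forall>y\<in>Y.
        (sim x y \<ge> S \<longrightarrow> measure H (collision H x y) \<ge> p1) \<and>
        (sim x y \<le> c * S \<longrightarrow> measure H (collision H x y) \<le> p2))"

definition ALSH ::
  "('x \<Rightarrow> 'y \<Rightarrow> real) \<Rightarrow> 'x set \<Rightarrow> 'y set \<Rightarrow> 'c set \<Rightarrow> real \<Rightarrow> real \<Rightarrow>
   (('x \<Rightarrow> 'c) \<times> ('y \<Rightarrow> 'c)) measure \<Rightarrow> bool" where
  "ALSH sim X Y \<Gamma> S c H \<longleftrightarrow>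
     (\<exists>p1\<in>{0..1}. \<exists>p2\<in>{0..1}. p1 > p2 \<and> ALSH_with sim X Y \<Gamma> S c p1 p2 H)"

definition universal_ALSH ::
  "('x \<Rightarrow> 'y \<Rightarrow> real) \<Rightarrow> 'x set \<Rightarrow> 'y set \<Rightarrow> 'c set \<Rightarrow>
   (('x \<Rightarrow> 'c) \<times> ('y \<Rightarrow> 'c)) measure \<Rightarrow> bool" where
  "universal_ALSH sim X Y \<Gamma> H \<longleftrightarrow>
     (\<forall>S c. 0 < S \<and> S < 1 \<and> 0 < c \<and> c < 1 \<longrightarrow> ALSH sim X Y \<Gamma> S c H)"

text \<open>
  \<open>\<real>\<^sup>d\<close> is \<open>real ^ 'n\<close> with \<open>d = CARD('n) \<ge> 1\<close>, and \<open>\<real>\<^sup>d\<^sup>+\<^sup>2\<close> is \<open>real ^ ('n + 2)\<close>, whose index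
  type is the disjoint sum of \<open>'n\<close> and the two-element type.
\<close>

definition vconcat :: "'a ^ 'm \<Rightarrow> 'a ^ 'n \<Rightarrow> 'a ^ ('m + 'n)" where
  "vconcat u v = (\<chi> i. case i of Inl j \<Rightarrow> u $ j | Inr k \<Rightarrow> v $ k)"

definition P_map :: "real ^ 'n \<Rightarrow> real ^ ('n + 2)" where
  "P_map x = vconcat x (vector [sqrt (1 - (norm x)\<^sup>2), 0])"

definition Q_map :: "real ^ 'n \<Rightarrow> real ^ ('n + 2)" where
  "Q_map x = vconcat x (vector [0, sqrt (1 - (norm x)\<^sup>2)])"

text \<open>Unlike \<^const>\<open>sgn\<close>, this takes the value 1 at 0.\<close>

definition sign_pm :: "real \<Rightarrow> real" where
  "sign_pm t = (if t \<ge> 0 then 1 else -1)"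

text \<open>The law \<open>N(0, I)\<close> on \<open>real ^ 'm\<close>: the coordinates are independent standard normals.\<close>

definition std_normal_vec :: "(real ^ 'm) measure" where
  "std_normal_vec = density lborel (\<lambda>a. ennreal (\<Prod>i\<in>UNIV. std_normal_density (a $ i)))"

definition X_bullet :: "(real ^ 'n) set" where
  "X_bullet = {x. norm x \<le> 1}"

definition simple_hash ::
  "real ^ ('n + 2) \<Rightarrow> (real ^ 'n \<Rightarrow> real) \<times> (real ^ 'n \<Rightarrow> real)" where
  "simple_hash a =
     ((\<lambda>x\<in>X_bullet. sign_pm (a \<bullet> P_map x)), (\<lambda>y\<in>X_bullet. sign_pm (a \<bullet> Q_map y)))"

text \<open>The joint law of \<open>(f, g)\<close>, on the product \<open>\<sigma>\<close>-algebra.\<close>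

definition simple_ALSH :: "((real ^ 'n \<Rightarrow> real) \<times> (real ^ 'n \<Rightarrow> real)) measure" where
  "simple_ALSH =
     distr std_normal_vec
       (PiM X_bullet (\<lambda>_. count_space {-1, 1}) \<Otimes>\<^sub>M PiM X_bullet (\<lambda>_. count_space {-1, 1}))
       simple_hash"

end

theory Submission
  imports Defs
begin

text \<open>
  \<open>P x\<close> and \<open>Q y\<close> are unit vectors with \<open>P x \<bullet> Q y = x \<bullet> y\<close>. Since the Gaussian measure is invariant
  under orthogonal maps, the collision probability of two unit vectors depends only on the angle
  between them. Putting them into a fixed plane, at angles \<open>0\<close> and \<open>\<theta>\<close>, the collision events are
  nested up to null sets when \<open>\<theta>\<close> varies, and any two of them differ by a set containing a nonempty
  open wedge. Hence the collision probability is a strictly increasing function \<open>F\<close> of \<open>x \<bullet> y\<close> (its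
  closed form is not needed), and \<open>p\<^sub>1 = F S\<close>, \<open>p\<^sub>2 = F (c * S)\<close> work.
\<close>

section \<open>Invariance of Lebesgue measure under orthogonal maps\<close>

lemma nn_integral_lborel_add:
  fixes t :: "'a::euclidean_space"
  assumes [measurable]: "f \<in> borel_measurable borel"
  shows "(\<integral>\<^sup>+x. f (t + x) \<partial>lborel) = (\<integral>\<^sup>+x. f x \<partial>lborel)"
proof -
  have "(\<integral>\<^sup>+x. f x \<partial>lborel) = (\<integral>\<^sup>+x. f x \<partial>distr lborel borel ((+) t))"
    by (simp only: lborel_distr_plus)
  also have "\<dots> = (\<integral>\<^sup>+x. f (t + x) \<partial>lborel)"
    by (rule nn_integral_distr) auto
  finally show ?thesis by simp
qed

lemma borel_measurable_orthogonal_transformation: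
  fixes T :: "'a::euclidean_space \<Rightarrow> 'a"
  assumes "orthogonal_transformation T"
  shows "T \<in> borel_measurable borel"
  using orthogonal_transformation_linear[OF assms]
  by (intro borel_measurable_continuous_onI linear_continuous_on) (simp add: linear_conv_bounded_linear)

text \<open>
  The library's change of variables for linear maps needs a well-ordered index type, which
  \<open>'n + 2\<close> is not. Instead, the uniqueness argument for Haar measure applies: the image measure is
  translation invariant and agrees with Lebesgue measure on the unit ball.
\<close>

lemma lborel_distr_orthogonal_transformation:
  fixes T :: "'a::euclidean_space \<Rightarrow> 'a"
  assumes T: "orthogonal_transformation T"
  shows "distr lborel borel T = lborel"
proof -
  have lin: "linear T" using T by (rule orthogonal_transformation_linear)
  have [measurable]: "T \<in> borel_measurable borel"
    using T by (rule borel_measurable_orthogonal_transformation)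
  note [simp] = linear_add[OF lin] linear_diff[OF lin]
  have surj: "\<exists>z. T z = x" for x
    using orthogonal_transformation_surj[OF T] by (metis surjD)
  \<comment> \<open>Writing \<open>x = T z\<close> turns a translation outside \<open>T\<close> into
    one of the argument, under which \<open>lborel\<close> is invariant.\<close>
  have shift: "(\<integral>\<^sup>+y. f (T y + x) \<partial>lborel) = (\<integral>\<^sup>+y. f (T y) \<partial>lborel)"
    if [measurable]: "f \<in> borel_measurable borel" for f :: "'a \<Rightarrow> ennreal" and x
  proof -
    obtain z where "T z = x" using surj by blast
    then show ?thesis
      using nn_integral_lborel_add[of "\<lambda>y. f (T y)" z] by (simp add: add.commute)
  qed
  let ?B = "ball 0 1 :: 'a set"
  have ball: "indicator ?B (T y) = (indicator ?B y :: ennreal)" for y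
    using orthogonal_transformation_norm[OF T] by (simp add: indicator_def)
  have [measurable]: "?B \<in> sets borel" by (intro borel_open open_ball)
  have B: "emeasure lborel ?B \<noteq> 0" "emeasure lborel ?B \<noteq> \<infinity>"
    using content_ball_pos[of 1 "0::'a"] emeasure_lborel_ball_finite[of "0::'a" 1]
    by (auto simp: measure_def)
  show ?thesis
  proof (rule measure_eqI)
    fix A assume "A \<in> sets (distr lborel borel T)"
    then have A[measurable]: "A \<in> sets borel" by simp
    \<comment> \<open>The product becomes a double integral; substituting \<open>T y + x\<close> for
      \<open>x\<close> moves \<open>T\<close> from the ball, where it is harmless, to
      \<open>A\<close>.\<close>
    have "emeasure lborel A * emeasure lborel ?B
        = (\<integral>\<^sup>+x. indicator A x * (\<integral>\<^sup>+y. indicator ?B (T y) \<partial>lborel) \<partial>lborel)"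
      by (simp add: ball nn_integral_multc)
    also have "\<dots> = (\<integral>\<^sup>+x. indicator A x * (\<integral>\<^sup>+y. indicator ?B (T y + - x) \<partial>lborel) \<partial>lborel)"
      by (subst shift) (auto intro: borel_measurable_indicator)
    also have "\<dots> = (\<integral>\<^sup>+x. (\<integral>\<^sup>+y. indicator A x * indicator ?B (T y - x) \<partial>lborel) \<partial>lborel)"
      by (subst nn_integral_cmult[symmetric]) auto
    also have "\<dots> = (\<integral>\<^sup>+y. (\<integral>\<^sup>+x. indicator A x * indicator ?B (T y - x) \<partial>lborel) \<partial>lborel)"
      by (rule lborel_pair.Fubini') auto
    also have "\<dots> = (\<integral>\<^sup>+y. (\<integral>\<^sup>+x. indicator A (T y + x) * indicator ?B (T y - (T y + x)) \<partial>lborel) \<partial>lborel)"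
      by (intro nn_integral_cong nn_integral_lborel_add[symmetric]) auto
    \<comment> \<open>The difference is \<open>- x\<close>, and the ball is symmetric about
      0.\<close>
    also have "\<dots> = (\<integral>\<^sup>+y. (\<integral>\<^sup>+x. indicator ?B x * indicator A (T y + x) \<partial>lborel) \<partial>lborel)"
      by (intro nn_integral_cong) (auto simp: indicator_def)
    also have "\<dots> = (\<integral>\<^sup>+x. (\<integral>\<^sup>+y. indicator ?B x * indicator A (T y + x) \<partial>lborel) \<partial>lborel)"
      by (rule lborel_pair.Fubini') auto
    also have "\<dots> = (\<integral>\<^sup>+x. indicator ?B x * (\<integral>\<^sup>+y. indicator A (T y + x) \<partial>lborel) \<partial>lborel)"
      by (subst nn_integral_cmult) auto
    also have "\<dots> = (\<integral>\<^sup>+x. indicator ?B x * (\<integral>\<^sup>+y. indicator A (T y) \<partial>lborel) \<partial>lborel)"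
      by (subst shift) auto
    also have "(\<integral>\<^sup>+y. indicator A (T y) \<partial>lborel) = (\<integral>\<^sup>+y. indicator A y \<partial>distr lborel borel T)"
      by (subst nn_integral_distr) auto
    also have "\<dots> = emeasure (distr lborel borel T) A"
      by simp
    also have "(\<integral>\<^sup>+x. indicator ?B x * emeasure (distr lborel borel T) A \<partial>lborel)
        = emeasure (distr lborel borel T) A * emeasure lborel ?B"
      by (subst nn_integral_multc) (auto simp: mult.commute)
    finally have "emeasure lborel A * emeasure lborel ?B / emeasure lborel ?B
        = emeasure (distr lborel borel T) A * emeasure lborel ?B / emeasure lborel ?B"
      by simp
    then show "emeasure (distr lborel borel T) A = emeasure lborel A"
      using B by (simp add: ennreal_mult_divide_eq)
  qed simp
qed

section \<open>The standard Gaussian measure\<close>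

lemma Basis_real_vec: "(Basis :: (real ^ 'm) set) = range (\<lambda>i. axis i 1)"
  by (auto simp: Basis_vec_def)

lemma prod_Basis_vec:
  "(\<Prod>b\<in>(Basis :: (real ^ 'm) set). f (x \<bullet> b)) = (\<Prod>i\<in>UNIV. f (x $ i))"
  unfolding Basis_real_vec
  by (subst prod.reindex) (auto simp: inj_on_def axis_eq_axis cart_eq_inner_axis)

lemma sets_std_normal_vec [measurable_cong, simp]: "sets std_normal_vec = sets borel"
  by (simp add: std_normal_vec_def)

lemma space_std_normal_vec [simp]: "space std_normal_vec = UNIV"
  by (simp add: std_normal_vec_def)

lemma prob_space_std_normal_vec: "prob_space (std_normal_vec :: (real ^ 'm) measure)"
proof (rule prob_spaceI)
  have "emeasure (std_normal_vec :: (real ^ 'm) measure) (space std_normal_vec)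
      = (\<integral>\<^sup>+x. (\<Prod>i\<in>UNIV. ennreal (std_normal_density ((x :: real ^ 'm) $ i))) \<partial>lborel)"
    by (simp add: std_normal_vec_def emeasure_density prod_ennreal)
  also have "\<dots> = (\<Prod>b\<in>(Basis :: (real ^ 'm) set). (\<integral>\<^sup>+x. ennreal (std_normal_density x) \<partial>lborel))"
    by (subst nn_integral_lborel_prod[symmetric]) (auto simp: prod_Basis_vec[of "\<lambda>t. ennreal (std_normal_density t)"])
  also have "\<dots> = 1"
    by (simp add: nn_integral_eq_integral)
  finally show "emeasure (std_normal_vec :: (real ^ 'm) measure) (space std_normal_vec) = 1" .
qed

text \<open>Exposes that the joint density depends on the norm alone, the source of rotation
  invariance.\<close>

lemma std_normal_density_prod:
  "(\<Prod>i\<in>UNIV. std_normal_density ((a :: real ^ 'm) $ i))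
    = (1 / sqrt (2 * pi)) ^ CARD('m) * exp (- (norm a)\<^sup>2 / 2)"
proof -
  have "(\<Sum>i\<in>UNIV. - (a $ i)\<^sup>2 / 2) = - (norm a)\<^sup>2 / 2"
    by (simp add: inner_vec_def sum_negf power2_norm_eq_inner power2_eq_square[of "_ $ _"] flip: sum_divide_distrib)
  then show ?thesis
    by (simp add: std_normal_density_def prod_dividef power_divide exp_sum[symmetric])
qed

lemma distr_std_normal_vec_orthogonal_transformation:
  fixes T :: "real ^ 'm \<Rightarrow> real ^ 'm"
  assumes T: "orthogonal_transformation T"
  shows "distr std_normal_vec borel T = std_normal_vec"
proof -
  have [measurable]: "T \<in> borel_measurable borel"
    using T by (rule borel_measurable_orthogonal_transformation)
  let ?g = "\<lambda>a :: real ^ 'm. ennreal (\<Prod>i\<in>UNIV. std_normal_density (a $ i))"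
  have g: "?g (T a) = ?g a" for a
    unfolding std_normal_density_prod by (simp add: orthogonal_transformation_norm[OF T])
  have "(std_normal_vec :: (real ^ 'm) measure) = density (distr lborel borel T) ?g"
    unfolding std_normal_vec_def by (simp add: lborel_distr_orthogonal_transformation[OF T])
  also have "\<dots> = distr (density lborel (\<lambda>a. ?g (T a))) borel T"
    by (rule density_distr) auto
  also have "\<dots> = distr std_normal_vec borel T"
    by (simp add: g std_normal_vec_def)
  finally show ?thesis by simp
qed

text \<open>The density is positive everywhere, so the Gaussian and Lebesgue measures have the same
  null sets.\<close>

lemma AE_std_normal_vec_iff:
  fixes P :: "real ^ 'm \<Rightarrow> bool"
  shows "(AE a in std_normal_vec. P a) \<longleftrightarrow> (AE a in lborel. P a)"
proof -
  have "0 < (\<Prod>i\<in>UNIV. std_normal_density ((a :: real ^ 'm) $ i))" for a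
    by (intro prod_pos) (auto simp: normal_density_pos)
  then show ?thesis
    unfolding std_normal_vec_def by (subst AE_density) auto
qed

lemma AE_std_normal_vec_inner_neq_0:
  fixes u :: "real ^ 'm"
  assumes "u \<noteq> 0"
  shows "AE a in std_normal_vec. a \<bullet> u \<noteq> 0"
proof -
  have "{a. u \<bullet> a = 0} \<in> null_sets lebesgue"
    using negligible_hyperplane[of u 0] assms by (simp add: negligible_iff_null_sets)
  then have "AE a in lebesgue. a \<bullet> u \<noteq> 0"
    by (intro AE_I'[of "{a. u \<bullet> a = 0}"]) (auto simp: inner_commute)
  then show ?thesis
    unfolding AE_std_normal_vec_iff by (simp add: AE_completion_iff)
qed

lemma measure_std_normal_vec_open_pos:
  fixes U :: "(real ^ 'm) set"
  assumes "open U" "U \<noteq> {}"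
  shows "measure std_normal_vec U > 0"
proof -
  interpret prob_space "std_normal_vec :: (real ^ 'm) measure" by (rule prob_space_std_normal_vec)
  have "prob U \<noteq> 0"
  proof
    assume "prob U = 0"
    then have "AE a in std_normal_vec. a \<notin> U"
      using assms(1) by (intro AE_not_in) (auto simp: null_sets_def emeasure_eq_measure)
    then have "AE a in lborel. a \<notin> U"
      by (simp add: AE_std_normal_vec_iff)
    then have "U \<in> null_sets lborel"
      using assms(1) by (subst (asm) AE_iff_null_sets[symmetric]) auto
    then have "negligible U"
      by (auto simp: negligible_iff_null_sets null_sets_completionI)
    then show False using open_not_negligible assms by blast
  qed
  then show ?thesis by (simp add: zero_less_measure_iff)
qed

section \<open>Moving pairs of vectors by reflections\<close>

text \<open>Reflection in the hyperplane orthogonal to \<open>n\<close>. For \<open>n = 0\<close>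
  the quotient is 0 and the map is the identity, so it is orthogonal for every
  \<open>n\<close>.\<close>

definition householder :: "'a::real_inner \<Rightarrow> 'a \<Rightarrow> 'a" where
  "householder n x = x - (2 * (x \<bullet> n) / (n \<bullet> n)) *\<^sub>R n"

lemma orthogonal_transformation_householder: "orthogonal_transformation (householder n)"
  unfolding orthogonal_transformation_def
proof (intro conjI allI)
  show "linear (householder n)"
    by (rule linearI) (simp_all add: householder_def inner_add algebra_simps add_divide_distrib)
  fix v w
  define k where "k x = 2 * (x \<bullet> n) / (n \<bullet> n)" for x
  have k: "k x * (n \<bullet> n) = 2 * (x \<bullet> n)" for x
    by (simp add: k_def)
  have "householder n v \<bullet> householder n w
      = v \<bullet> w - k w * (v \<bullet> n) - k v * (w \<bullet> n) + k v * (k w * (n \<bullet> n))"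
    unfolding householder_def k_def[symmetric] by (simp add: inner_diff inner_commute[of n w] algebra_simps)
  also have "\<dots> = v \<bullet> w"
    unfolding k by (simp add: k_def)
  finally show "householder n v \<bullet> householder n w = v \<bullet> w" .
qed

lemma householder_diff:
  fixes x y :: "'a::real_inner"
  assumes "norm x = norm y"
  shows "householder (x - y) x = y"
proof (cases "x = y")
  case False
  have "2 * (x \<bullet> (x - y)) = (x - y) \<bullet> (x - y)"
    using assms by (simp add: norm_eq inner_diff inner_commute)
  with False show ?thesis by (simp add: householder_def)
qed (simp add: householder_def)

text \<open>Two reflections suffice: the first takes \<open>u\<close> to \<open>u'\<close> and
  \<open>v\<close> to some \<open>w\<close>; the second takes \<open>w\<close> to \<open>v'\<close>
  and fixes \<open>u'\<close>, because equal inner products make \<open>w - v'\<close> orthogonal to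
  \<open>u'\<close>.\<close>

lemma orthogonal_transformation_exists_pair:
  fixes u v u' v' :: "real ^ 'm"
  assumes "norm u = norm u'" "norm v = norm v'" "u \<bullet> v = u' \<bullet> v'"
  obtains T where "orthogonal_transformation T" "T u = u'" "T v = v'"
proof -
  let ?R = "householder (u - u')"
  define w where "w = ?R v"
  have R: "orthogonal_transformation ?R" by (rule orthogonal_transformation_householder)
  have Ru: "?R u = u'" by (rule householder_diff) fact
  have "?R v \<bullet> ?R u = v \<bullet> u"
    using R unfolding orthogonal_transformation_def by blast
  then have "w \<bullet> u' = v \<bullet> u"
    by (simp only: Ru w_def)
  then have "u' \<bullet> (w - v') = 0"
    using assms(3) by (simp add: inner_diff inner_commute)
  then have fix_u': "householder (w - v') u' = u'"
    by (simp add: householder_def)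
  have w: "householder (w - v') w = v'"
    using assms(2) by (intro householder_diff) (simp add: w_def orthogonal_transformation_norm[OF R])
  show thesis
  proof (rule that)
    show "orthogonal_transformation (\<lambda>x. householder (w - v') (?R x))"
      using orthogonal_transformation_compose[OF orthogonal_transformation_householder R]
      by (simp only: comp_def)
    show "householder (w - v') (?R u) = u'" unfolding Ru by (rule fix_u')
    show "householder (w - v') (?R v) = v'" using w by (simp only: w_def)
  qed
qed

section \<open>Gaussian collision probability as a function of the angle\<close>

lemma sign_pm_eq_iff: "sign_pm s = sign_pm t \<longleftrightarrow> (s \<ge> 0 \<longleftrightarrow> t \<ge> 0)"
  by (simp add: sign_pm_def)

definition gauss_collision :: "real ^ 'm \<Rightarrow> real ^ 'm \<Rightarrow> real" where
  "gauss_collision u v = measure std_normal_vec {a. sign_pm (a \<bullet> u) = sign_pm (a \<bullet> v)}"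

lemma borel_collision_event [measurable]:
  "{a :: real ^ 'm. sign_pm (a \<bullet> u) = sign_pm (a \<bullet> v)} \<in> sets borel"
  unfolding sign_pm_eq_iff by measurable

text \<open>An orthogonal map carries one pair to the other and preserves the Gaussian law.\<close>

lemma gauss_collision_cong:
  fixes u v u' v' :: "real ^ 'm"
  assumes "norm u = norm u'" "norm v = norm v'" "u \<bullet> v = u' \<bullet> v'"
  shows "gauss_collision u v = gauss_collision u' v'"
proof -
  obtain T where T: "orthogonal_transformation T" "T u = u'" "T v = v'"
    using assms by (rule orthogonal_transformation_exists_pair)
  have [measurable]: "T \<in> borel_measurable borel"
    using T(1) by (rule borel_measurable_orthogonal_transformation)
  have "gauss_collision u' v'
      = measure (distr std_normal_vec borel T) {a. sign_pm (a \<bullet> u') = sign_pm (a \<bullet> v')}"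
    by (simp add: gauss_collision_def distr_std_normal_vec_orthogonal_transformation[OF T(1)])
  also have "\<dots> = measure std_normal_vec {a. sign_pm (T a \<bullet> T u) = sign_pm (T a \<bullet> T v)}"
    by (subst measure_distr) (auto simp: T vimage_def)
  also have "\<dots> = gauss_collision u v"
    using T(1) by (simp add: gauss_collision_def orthogonal_transformation_def)
  finally show ?thesis by simp
qed

text \<open>
  For \<open>\<alpha> = a \<bullet> u\<close> and \<open>\<beta> = a \<bullet> w\<close>, this makes the collision event of \<open>u\<close> with the vector at
  angle \<open>\<theta>\<close> to \<open>u\<close> decrease in \<open>\<theta>\<close>, outside the null set \<open>\<alpha> = 0\<close>.
\<close>

lemma rotated_half_plane:
  fixes \<theta> \<eta> \<alpha> \<beta> :: real
  assumes "0 \<le> \<eta>" "\<eta> < \<theta>" "\<theta> \<le> pi" "\<alpha> > 0" "cos \<theta> * \<alpha> + sin \<theta> * \<beta> \<ge> 0"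
  shows "cos \<eta> * \<alpha> + sin \<eta> * \<beta> > 0"
proof -
  \<comment> \<open>At \<open>pi\<close> the last assumption would read
    \<open>- \<alpha> \<ge> 0\<close>.\<close>
  have "\<theta> \<noteq> pi" using assms by auto
  then have pos: "sin \<theta> > 0" "sin (\<theta> - \<eta>) > 0" "sin \<eta> \<ge> 0"
    using assms by (auto intro!: sin_gt_zero sin_ge_zero)
  have "sin \<theta> * (cos \<eta> * \<alpha> + sin \<eta> * \<beta>)
      = sin \<eta> * (cos \<theta> * \<alpha> + sin \<theta> * \<beta>) + sin (\<theta> - \<eta>) * \<alpha>"
    by (simp add: sin_diff algebra_simps)
  also have "\<dots> > 0"
    using pos assms by (intro add_nonneg_pos mult_nonneg_nonneg mult_pos_pos) auto
  finally show ?thesis using pos by (simp add: zero_less_mult_iff)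
qed

text \<open>The event at \<open>\<theta>\<close> and the wedge \<open>U\<close> are disjoint, and
  both lie in the event at \<open>\<eta>\<close> up to a null set; \<open>U\<close> has positive
  measure, which makes the inequality strict.\<close>

lemma gauss_collision_strict_antimono:
  fixes u w :: "real ^ 'm"
  assumes uw: "norm u = 1" "norm w = 1" "u \<bullet> w = 0" and ang: "0 \<le> \<eta>" "\<eta> < \<theta>" "\<theta> \<le> pi"
  shows "gauss_collision u (cos \<theta> *\<^sub>R u + sin \<theta> *\<^sub>R w)
       < gauss_collision u (cos \<eta> *\<^sub>R u + sin \<eta> *\<^sub>R w)"
proof -
  interpret prob_space "std_normal_vec :: (real ^ 'm) measure" by (rule prob_space_std_normal_vec)
  let ?v = "\<lambda>\<theta>. cos \<theta> *\<^sub>R u + sin \<theta> *\<^sub>R w"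
  let ?E = "\<lambda>\<theta>. {a. sign_pm (a \<bullet> u) = sign_pm (a \<bullet> ?v \<theta>)}"
  define U where "U = {a. 0 < a \<bullet> u \<and> 0 < a \<bullet> ?v \<eta> \<and> a \<bullet> ?v \<theta> < 0}"
  have "open U"
    unfolding U_def by (intro open_Collect_conj open_Collect_less continuous_intros)
  then have [measurable]: "U \<in> sets borel" by simp
  have dots: "u \<bullet> u = 1" "w \<bullet> w = 1" "w \<bullet> u = 0"
    using uw by (auto simp: norm_eq_1 inner_commute)
  define m where "m = (\<theta> + \<eta>) / 2"
  \<comment> \<open>The vector at angle \<open>m - pi / 2\<close>, orthogonal to the bisector of
    \<open>?v \<eta>\<close> and \<open>?v \<theta>\<close>, hence on different sides of the
    two.\<close>
  let ?a = "sin m *\<^sub>R u - cos m *\<^sub>R w"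
  have dot: "?a \<bullet> ?v \<phi> = sin (m - \<phi>)" for \<phi>
    using dots uw(3) by (simp add: inner_diff inner_add sin_diff algebra_simps)
  have "?a \<in> U"
    unfolding U_def mem_Collect_eq dot
  proof (intro conjI)
    show "0 < ?a \<bullet> u" using ang dots by (auto simp: m_def inner_diff intro!: sin_gt_zero)
    show "0 < sin (m - \<eta>)" using ang by (intro sin_gt_zero) (auto simp: m_def field_simps)
    have "0 < sin (\<theta> - m)" using ang by (intro sin_gt_zero) (auto simp: m_def field_simps)
    then show "sin (m - \<theta>) < 0" using sin_minus[of "\<theta> - m"] by simp
  qed
  then have "prob U > 0"
    using \<open>open U\<close> by (intro measure_std_normal_vec_open_pos) auto
  moreover have "prob (?E \<theta>) + prob U \<le> prob (?E \<eta>)"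
  proof -
    have "u \<noteq> 0" using uw by auto
    have incl: "a \<in> ?E \<eta>" if "a \<bullet> u \<noteq> 0" "a \<in> ?E \<theta> \<union> U" for a
    proof (cases "a \<in> U")
      case True
      then show ?thesis by (auto simp: U_def sign_pm_eq_iff)
    next
      case False
      then have "a \<in> ?E \<theta>" using that by auto
      \<comment> \<open>The second instance treats \<open>a \<bullet> u < 0\<close> by passing to
        \<open>- a\<close>.\<close>
      then show ?thesis
        using that(1) rotated_half_plane[OF ang, of "a \<bullet> u" "a \<bullet> w"]
          rotated_half_plane[OF ang, of "- (a \<bullet> u)" "- (a \<bullet> w)"]
        by (auto simp: sign_pm_eq_iff inner_add not_le)
    qed
    have "prob (?E \<theta>) + prob U = prob (?E \<theta> \<union> U)"
      by (rule finite_measure_Union[symmetric]) (auto simp: U_def sign_pm_eq_iff)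
    also have "\<dots> \<le> prob (?E \<eta>)"
    proof (rule finite_measure_mono_AE)
      show "AE a in std_normal_vec. a \<in> ?E \<theta> \<union> U \<longrightarrow> a \<in> ?E \<eta>"
        using AE_std_normal_vec_inner_neq_0[OF \<open>u \<noteq> 0\<close>] by eventually_elim (use incl in blast)
    qed simp
    finally show ?thesis .
  qed
  ultimately show ?thesis
    unfolding gauss_collision_def by linarith
qed

section \<open>The embeddings into the unit sphere\<close>

lemma inner_vconcat: "vconcat u v \<bullet> vconcat u' v' = u \<bullet> u' + v \<bullet> (v' :: real ^ _)"
  unfolding inner_vec_def UNIV_Plus_UNIV[symmetric]
  by (subst sum.Plus) (auto simp: vconcat_def)

text \<open>The padding entry completes the norm to 1; \<open>P_map\<close> and \<open>Q_map\<close>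
  pad different coordinates, so the padding adds nothing to the inner product.\<close>

lemma norm_P_map: "norm x \<le> 1 \<Longrightarrow> norm (P_map x) = 1"
  and norm_Q_map: "norm x \<le> 1 \<Longrightarrow> norm (Q_map x) = 1"
  and inner_P_map_Q_map: "P_map x \<bullet> Q_map y = x \<bullet> y"
  unfolding norm_eq_1 P_map_def Q_map_def inner_vconcat inner_vec_def[of "_ :: real ^ 2"] sum_2
  by (simp_all add: abs_le_square_iff power2_norm_eq_inner[symmetric] abs_square_le_1)

lemma gauss_collision_eq_strict_mono:
  obtains F :: "real \<Rightarrow> real" where
    "\<And>s t. - 1 \<le> s \<Longrightarrow> s < t \<Longrightarrow> t \<le> 1 \<Longrightarrow> F s < F t"
    "\<And>x y :: real ^ 'n. norm x \<le> 1 \<Longrightarrow> norm y \<le> 1 \<Longrightarrow>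
       gauss_collision (P_map x) (Q_map y) = F (x \<bullet> y)"
proof -
  \<comment> \<open>The two appended coordinates supply an orthonormal pair even when
    \<open>'n\<close> has a single index.\<close>
  define u w :: "real ^ ('n + 2)" where "u = axis (Inr 1) 1" and "w = axis (Inr 2) 1"
  have uw: "norm u = 1" "norm w = 1" "u \<bullet> w = 0"
    by (simp_all add: u_def w_def inner_axis_axis)
  define v where "v t = cos (arccos t) *\<^sub>R u + sin (arccos t) *\<^sub>R w" for t
  show thesis
  proof (rule that)
    \<comment> \<open>\<open>arccos\<close> is strictly decreasing, so decrease in the angle becomes
      increase in its cosine.\<close>
    show "gauss_collision u (v s) < gauss_collision u (v t)" if "- 1 \<le> s" "s < t" "t \<le> 1" for s t
      unfolding v_def using that
      by (intro gauss_collision_strict_antimono uw arccos_less_arccos arccos_lbound arccos_ubound) auto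
    show "gauss_collision (P_map x) (Q_map y) = gauss_collision u (v (x \<bullet> y))"
      if "norm x \<le> 1" "norm y \<le> 1" for x y :: "real ^ 'n"
    proof (rule gauss_collision_cong)
      have "\<bar>x \<bullet> y\<bar> \<le> norm x * norm y" by (rule Cauchy_Schwarz_ineq2)
      also have "\<dots> \<le> 1" using that by (intro mult_le_one) auto
      finally have "cos (arccos (x \<bullet> y)) = x \<bullet> y" by (intro cos_arccos) auto
      then show "P_map x \<bullet> Q_map y = u \<bullet> v (x \<bullet> y)"
        using uw by (simp add: inner_P_map_Q_map v_def inner_add norm_eq_1)
      have "v (x \<bullet> y) \<bullet> v (x \<bullet> y) = 1"
        using uw sin_cos_squared_add[of "arccos (x \<bullet> y)"]
        by (simp add: v_def inner_add norm_eq_1 inner_commute power2_eq_square)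
      then show "norm (Q_map y) = norm (v (x \<bullet> y))"
        using that by (simp add: norm_Q_map norm_eq_1)
    qed (use that uw in \<open>auto simp: norm_P_map\<close>)
  qed
qed

section \<open>The law of the hash and its collision events\<close>

lemma measurable_simple_hash [measurable]:
  "simple_hash \<in> std_normal_vec \<rightarrow>\<^sub>M
     PiM (X_bullet :: (real ^ 'n) set) (\<lambda>_. count_space {-1, 1}) \<Otimes>\<^sub>M PiM X_bullet (\<lambda>_. count_space {-1, 1})"
proof -
  have "(\<lambda>a. sign_pm (a \<bullet> v)) \<in> std_normal_vec \<rightarrow>\<^sub>M count_space {-1, 1}" for v :: "real ^ ('n + 2)"
    unfolding sign_pm_def by (intro measurable_If) auto
  then show ?thesis
    unfolding simple_hash_def by (intro measurable_Pair measurable_restrict)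
qed

lemma
  fixes x y :: "real ^ 'n"
  assumes "x \<in> X_bullet" "y \<in> X_bullet"
  shows sets_collision: "collision simple_ALSH x y \<in> sets simple_ALSH"
    and measure_collision:
      "measure simple_ALSH (collision simple_ALSH x y) = gauss_collision (P_map x) (Q_map y)"
proof -
  let ?H = "simple_ALSH :: ((real ^ 'n \<Rightarrow> real) \<times> (real ^ 'n \<Rightarrow> real)) measure"
  let ?C = "count_space {-1, 1 :: real}"
  let ?M = "PiM (X_bullet :: (real ^ 'n) set) (\<lambda>_. ?C) \<Otimes>\<^sub>M PiM (X_bullet :: (real ^ 'n) set) (\<lambda>_. ?C)"
  have M: "sets ?H = sets ?M" by (simp add: simple_ALSH_def)
  have fst: "(\<lambda>h. fst h x) \<in> ?M \<rightarrow>\<^sub>M ?C" and snd: "(\<lambda>h. snd h y) \<in> ?M \<rightarrow>\<^sub>M ?C"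
    using assms by measurable
  have "collision ?H x y = {h \<in> space ?M. fst h x = snd h y}"
    by (auto simp: collision_def sets_eq_imp_space_eq[OF M])
  \<comment> \<open>Splitting by the common hash value, of which there are only two, gives
    measurability.\<close>
  also have "\<dots> = (\<Union>c\<in>{-1, 1}. ((\<lambda>h. fst h x) -` {c} \<inter> space ?M) \<inter> ((\<lambda>h. snd h y) -` {c} \<inter> space ?M))"
    using measurable_space[OF fst] by fastforce
  also have "\<dots> \<in> sets ?M"
    by (intro sets.finite_UN sets.Int measurable_sets[OF fst] measurable_sets[OF snd]) auto
  finally show S: "collision ?H x y \<in> sets ?H" by (simp add: M)
  have "measure ?H (collision ?H x y)
     = measure std_normal_vec (simple_hash -` collision ?H x y \<inter> space std_normal_vec)"
    using S unfolding M by (subst simple_ALSH_def) (rule measure_distr[OF measurable_simple_hash])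
  also have "simple_hash -` collision ?H x y \<inter> space std_normal_vec
     = {a. sign_pm (a \<bullet> P_map x) = sign_pm (a \<bullet> Q_map y)}"
    using assms measurable_space[OF measurable_simple_hash]
    by (auto simp: collision_def sets_eq_imp_space_eq[OF M] simple_hash_def)
  finally show "measure ?H (collision ?H x y) = gauss_collision (P_map x) (Q_map y)"
    by (simp add: gauss_collision_def)
qed

lemma asymmetric_hash_simple_ALSH:
  "asymmetric_hash X_bullet X_bullet {-1, 1} (simple_ALSH :: ((real ^ 'n \<Rightarrow> real) \<times> _) measure)"
  unfolding asymmetric_hash_def
proof (intro conjI ballI sets_collision)
  show "prob_space (simple_ALSH :: ((real ^ 'n \<Rightarrow> real) \<times> _) measure)"
    unfolding simple_ALSH_def
    by (intro prob_space.prob_space_distr prob_space_std_normal_vec measurable_simple_hash)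
qed (auto simp: simple_ALSH_def space_pair_measure space_PiM)

theorem theorem5p3:
  "universal_ALSH (\<lambda>(x :: real ^ 'n) (y :: real ^ 'n). x \<bullet> y) X_bullet X_bullet {-1, 1} simple_ALSH"
  unfolding universal_ALSH_def
proof (intro allI impI)
  fix S c :: real
  assume "0 < S \<and> S < 1 \<and> 0 < c \<and> c < 1"
  then have S: "0 < S" "S < 1" and c: "0 < c * S" "c * S < S" by auto
  let ?X = "X_bullet :: (real ^ 'n) set"
  let ?H = "simple_ALSH :: ((real ^ 'n \<Rightarrow> real) \<times> (real ^ 'n \<Rightarrow> real)) measure"
  obtain F where mono: "\<And>s t. - 1 \<le> s \<Longrightarrow> s < t \<Longrightarrow> t \<le> 1 \<Longrightarrow> F s < F t"
    and F: "\<And>x y :: real ^ 'n. norm x \<le> 1 \<Longrightarrow> norm y \<le> 1 \<Longrightarrow>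
       gauss_collision (P_map x) (Q_map y) = F (x \<bullet> y)"
    by (rule gauss_collision_eq_strict_mono[where 'n = 'n]) blast
  have le: "F s \<le> F t" if "- 1 \<le> s" "s \<le> t" "t \<le> 1" for s t
    using mono[of s t] that by (cases "s = t") auto
  have H: "measure ?H (collision ?H x y) = F (x \<bullet> y)" if "x \<in> ?X" "y \<in> ?X" for x y
    using that measure_collision[of x y] F[of x y] by (simp add: X_bullet_def)
  have inner: "\<bar>x \<bullet> y\<bar> \<le> 1" if "x \<in> ?X" "y \<in> ?X" for x y
    using that Cauchy_Schwarz_ineq2[of x y] mult_le_one[of "norm x" "norm y"]
    by (simp add: X_bullet_def)
  \<comment> \<open>Each such \<open>F t\<close> is the collision probability of an actual pair, a
    unit axis vector and its multiple by \<open>t\<close>.\<close>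
  have F01: "F t \<in> {0..1}" if "\<bar>t\<bar> \<le> 1" for t
  proof -
    interpret prob_space ?H using asymmetric_hash_simple_ALSH by (auto simp: asymmetric_hash_def)
    obtain i :: 'n where True by blast
    have "axis i 1 \<in> ?X" "t *\<^sub>R axis i 1 \<in> ?X" using that by (auto simp: X_bullet_def)
    from H[OF this] have "F t = prob (collision ?H (axis i 1) (t *\<^sub>R axis i 1))"
      by (simp add: inner_axis_axis)
    then show ?thesis by simp
  qed
  show "ALSH (\<lambda>x y. x \<bullet> y) ?X ?X {-1, 1} S c ?H"
    unfolding ALSH_def ALSH_with_def
  proof (intro bexI conjI ballI impI asymmetric_hash_simple_ALSH)
    show "F (c * S) < F S" using S c by (intro mono) auto
    show "F S \<in> {0..1}" "F (c * S) \<in> {0..1}" using S c by (intro F01; simp)+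
    fix x y assume xy: "x \<in> ?X" "y \<in> ?X"
    show "F S \<le> measure ?H (collision ?H x y)" if "S \<le> x \<bullet> y"
      using inner[OF xy] that S unfolding H[OF xy] by (intro le) auto
    show "measure ?H (collision ?H x y) \<le> F (c * S)" if "x \<bullet> y \<le> c * S"
      using inner[OF xy] that S c unfolding H[OF xy] by (intro le) auto
  qed
qed

end
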